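(* Let $p$ be a prime, let $m \le n$ be positive integers, and let $V$ and $W$ be elementary abelian groups of orders $p^n$ and $p^m$ respectively, viewed additively. Let $\alpha : V \times V \rightarrow W$ be a generalized nonsingular map and let $\beta : V \times V \rightarrow W$ be a biadditive map. Consider the set $G = V \times V \times W$ and define a multiplication on $G$ by $$(a_1,b_1,c_1)(a_2,b_2,c_2) = (a_1+a_2,\ b_1+b_2,\ c_1+c_2+\alpha(a_1,b_2)+\beta(b_1,b_2)).$$ Then the following hold: (1) $G$ is a semi-extraspecial group with $G' = Z(G) = \{(0,0,c) \mid c \in W\}$. (2) $[(a_1,b_1,c_1),(a_2,b_2,c_2)] = (0,0,\alpha(a_1,b_2) - \alpha(a_2,b_1) + \overline{\beta}(b_1,b_2))$ for all elements of $G$. (3) If $p$ is odd, $G$ has exponent $p$. (4) $A = \{(a,0,c) \mid a \in V, c \in W\}$ is an abelian subgroup of order $p^{n+m}$. (5) $B = \{(0,b,c) \mid b \in V, c \in W\}$ is a subgroup of order $p^{n+m}$. (6) $G = AB$ and $A \cap B = G'$. (7) For an element $v \in V \setminus \{0\}$, we have $\overline{\beta}(u,v) = 0$ for all $u \in V$ if and only if $(0,v,c) \in Z(B)$ for all $c \in W$. In particular, for $c\in W$, $B \le C_G((0,v,c))$ if and only if $\overline{\beta}(u,v) = 0$ for all $u \in V$. (8) $\overline{\beta}(u,v) = 0$ for all $u,v \in V$ if and only if $B$ is abelian.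
   Context: A finite $p$-group $G$ is semi-extraspecial if for every subgroup $N$ of index $p$ in $Z(G)$ the quotient $G/N$ is an extraspecial group. A map $\alpha : V \times V \to W$ is a generalized nonsingular map if it is biadditive and $\alpha(v,V) = \alpha(V,v) = W$ for every $v \in V$ with $v \neq 0$, where $\alpha(v,V)=\{\alpha(v,u) : u\in V\}$ and $\alpha(V,v)=\{\alpha(u,v) : u \in V\}$. For a biadditive map $\beta : V \times V \to W$, define $\overline{\beta}(b_1,b_2) = \beta(b_1,b_2) - \beta(b_2,b_1)$ for all $b_1,b_2\in V$. *)

theory Defs
  imports "HOL-Algebra.Ring" "HOL-Algebra.Generated_Groups" "HOL-Computational_Algebra.Primes"
begin

text \<open>Finiteness is implied: \<^term>\<open>order G\<close> is 0 when the carrier is infinite.\<close>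

definition finite_p_group :: "nat \<Rightarrow> ('a, 'b) monoid_scheme \<Rightarrow> bool" where
  "finite_p_group p G \<longleftrightarrow> Factorial_Ring.prime p \<and> group G \<and> (\<exists>k. order G = p ^ k)"

definition elementary_abelian :: "nat \<Rightarrow> ('a, 'b) monoid_scheme \<Rightarrow> bool" where
  "elementary_abelian p G \<longleftrightarrow>
     Factorial_Ring.prime p \<and> comm_group G \<and> (\<forall>x\<in>carrier G. x [^]\<^bsub>G\<^esub> p = \<one>\<^bsub>G\<^esub>)"

definition group_center :: "('a, 'b) monoid_scheme \<Rightarrow> 'a set" where
  "group_center G = {z \<in> carrier G. \<forall>x\<in>carrier G. z \<otimes>\<^bsub>G\<^esub> x = x \<otimes>\<^bsub>G\<^esub> z}"

definition centralizer :: "('a, 'b) monoid_scheme \<Rightarrow> 'a \<Rightarrow> 'a set" where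
  "centralizer G g = {x \<in> carrier G. x \<otimes>\<^bsub>G\<^esub> g = g \<otimes>\<^bsub>G\<^esub> x}"

definition commutator :: "('a, 'b) monoid_scheme \<Rightarrow> 'a \<Rightarrow> 'a \<Rightarrow> 'a" where
  "commutator G x y = inv\<^bsub>G\<^esub> x \<otimes>\<^bsub>G\<^esub> inv\<^bsub>G\<^esub> y \<otimes>\<^bsub>G\<^esub> x \<otimes>\<^bsub>G\<^esub> y"

text \<open>Meaningful only for groups of finite exponent, such as finite groups.\<close>

definition group_exponent :: "('a, 'b) monoid_scheme \<Rightarrow> nat" where
  "group_exponent G = (LEAST n. 0 < n \<and> (\<forall>x\<in>carrier G. x [^]\<^bsub>G\<^esub> n = \<one>\<^bsub>G\<^esub>))"

text \<open>The usual condition \<open>Z(P) = P' = \<Phi>(P)\<close> of order \<open>p\<close>, with the part about the Frattini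
  subgroup expressed by \<open>P/Z(P)\<close> being elementary abelian.\<close>

definition extraspecial :: "nat \<Rightarrow> ('a, 'b) monoid_scheme \<Rightarrow> bool" where
  "extraspecial p P \<longleftrightarrow>
     finite_p_group p P \<and>
     derived P (carrier P) = group_center P \<and>
     card (group_center P) = p \<and>
     elementary_abelian p (P Mod group_center P)"

definition semi_extraspecial :: "nat \<Rightarrow> ('a, 'b) monoid_scheme \<Rightarrow> bool" where
  "semi_extraspecial p G \<longleftrightarrow>
     finite_p_group p G \<and>
     (\<forall>N. subgroup N (G\<lparr>carrier := group_center G\<rparr>) \<and>
          card (rcosets\<^bsub>G\<lparr>carrier := group_center G\<rparr>\<^esub> N) = p
        \<longrightarrow> extraspecial p (G Mod N))"

text \<open>Additively written abelian groups are \<^locale>\<open>abelian_group\<close> structures; the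
  multiplicative fields of these ring records are arbitrary and never used.\<close>

definition biadditive ::
  "('v, 'k) ring_scheme \<Rightarrow> ('w, 'l) ring_scheme \<Rightarrow> ('v \<Rightarrow> 'v \<Rightarrow> 'w) \<Rightarrow> bool" where
  "biadditive V W \<alpha> \<longleftrightarrow>
     (\<forall>v\<in>carrier V. (\<lambda>u. \<alpha> v u) \<in> hom (add_monoid V) (add_monoid W)) \<and>
     (\<forall>v\<in>carrier V. (\<lambda>u. \<alpha> u v) \<in> hom (add_monoid V) (add_monoid W))"

definition generalized_nonsingular ::
  "('v, 'k) ring_scheme \<Rightarrow> ('w, 'l) ring_scheme \<Rightarrow> ('v \<Rightarrow> 'v \<Rightarrow> 'w) \<Rightarrow> bool" where
  "generalized_nonsingular V W \<alpha> \<longleftrightarrow>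
     biadditive V W \<alpha> \<and>
     (\<forall>v\<in>carrier V. v \<noteq> \<zero>\<^bsub>V\<^esub> \<longrightarrow>
        {\<alpha> v u | u. u \<in> carrier V} = carrier W \<and>
        {\<alpha> u v | u. u \<in> carrier V} = carrier W)"

definition skew_part :: "('w, 'l) ring_scheme \<Rightarrow> ('v \<Rightarrow> 'v \<Rightarrow> 'w) \<Rightarrow> 'v \<Rightarrow> 'v \<Rightarrow> 'w" where
  "skew_part W \<beta> b\<^sub>1 b\<^sub>2 = \<beta> b\<^sub>1 b\<^sub>2 \<ominus>\<^bsub>W\<^esub> \<beta> b\<^sub>2 b\<^sub>1"

definition twisted_group ::
  "('v, 'k) ring_scheme \<Rightarrow> ('w, 'l) ring_scheme \<Rightarrow> ('v \<Rightarrow> 'v \<Rightarrow> 'w) \<Rightarrow> ('v \<Rightarrow> 'v \<Rightarrow> 'w)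
     \<Rightarrow> ('v \<times> 'v \<times> 'w) monoid" where
  "twisted_group V W \<alpha> \<beta> =
     \<lparr>carrier = carrier V \<times> carrier V \<times> carrier W,
      monoid.mult = (\<lambda>(a\<^sub>1, b\<^sub>1, c\<^sub>1) (a\<^sub>2, b\<^sub>2, c\<^sub>2).
        (a\<^sub>1 \<oplus>\<^bsub>V\<^esub> a\<^sub>2, b\<^sub>1 \<oplus>\<^bsub>V\<^esub> b\<^sub>2, c\<^sub>1 \<oplus>\<^bsub>W\<^esub> c\<^sub>2 \<oplus>\<^bsub>W\<^esub> \<alpha> a\<^sub>1 b\<^sub>2 \<oplus>\<^bsub>W\<^esub> \<beta> b\<^sub>1 b\<^sub>2)),
      monoid.one = (\<zero>\<^bsub>V\<^esub>, \<zero>\<^bsub>V\<^esub>, \<zero>\<^bsub>W\<^esub>)\<rparr>"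

end

theory Submission
  imports Defs "HOL-Algebra.Multiplicative_Group"
begin

text \<open>Two elements of \<open>G\<close> commute up to the central factor
  \<open>\<alpha> a\<^sub>1 b\<^sub>2 - \<alpha> a\<^sub>2 b\<^sub>1 + (\<beta> b\<^sub>1 b\<^sub>2 - \<beta> b\<^sub>2 b\<^sub>1)\<close>. If \<open>(a\<^sub>1, b\<^sub>1) \<noteq> 0\<close>, nonsingularity of
  \<open>\<alpha>\<close> makes this factor run through all of \<open>W\<close>: vary \<open>a\<^sub>2\<close> with \<open>b\<^sub>2 = 0\<close> if
  \<open>b\<^sub>1 \<noteq> 0\<close>, and vary \<open>b\<^sub>2\<close> otherwise. Hence for every noncentral \<open>x\<close> the commutators
  \<open>[x, y]\<close> exhaust the centre \<open>Z\<close>. This property forces \<open>G' = Z\<close>, and it makes \<open>x\<close> noncentral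
  modulo every proper subgroup \<open>N\<close> of \<open>Z\<close>, so \<open>Z(G/N) = Z/N\<close> and \<open>G/N\<close> is extraspecial
  when \<open>N\<close> has index \<open>p\<close>.
  Since \<open>(a, b, c)\<^sup>k = (k a, k b, k c + (k choose 2) (\<alpha> a b + \<beta> b b))\<close>, the exponent is \<open>p\<close>
  when \<open>p\<close> divides \<open>p choose 2\<close>, that is, when \<open>p\<close> is odd.\<close>

lemma (in group) group_center_subgroup: "subgroup (group_center G) G"
proof (rule subgroupI)
  fix x assume x: "x \<in> group_center G"
  have "inv x \<otimes> y = y \<otimes> inv x" if "y \<in> carrier G" for y
  proof -
    have "x \<otimes> y = y \<otimes> x" "x \<in> carrier G" using x that by (auto simp: group_center_def)
    then show ?thesis using that by (simp add: inv_solve_left' inv_solve_right' flip: m_assoc)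
       (simp add: m_assoc)
  qed
  with x show "inv x \<in> group_center G"
    by (auto simp: group_center_def)
next
  fix x y assume "x \<in> group_center G" "y \<in> group_center G"
  then have xy: "x \<in> carrier G" "y \<in> carrier G"
    and x: "\<And>w. w \<in> carrier G \<Longrightarrow> x \<otimes> w = w \<otimes> x"
    and y: "\<And>w. w \<in> carrier G \<Longrightarrow> y \<otimes> w = w \<otimes> y"
    by (auto simp: group_center_def)
  have "x \<otimes> y \<otimes> w = w \<otimes> (x \<otimes> y)" if w: "w \<in> carrier G" for w
  proof -
    have "x \<otimes> y \<otimes> w = x \<otimes> w \<otimes> y" using xy w y[OF w] by (simp add: m_assoc)
    then show ?thesis using xy w x[OF w] by (simp add: m_assoc)
  qed
  with xy show "x \<otimes> y \<in> group_center G" by (simp add: group_center_def)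
qed (auto simp: group_center_def)

lemma (in group) subgroup_center_normal:
  assumes "subgroup N (G\<lparr>carrier := group_center G\<rparr>)"
  shows "N \<lhd> G"
proof -
  have "subgroup N G"
    using incl_subgroup[OF group_center_subgroup assms] .
  moreover have "N \<subseteq> group_center G"
    using subgroup.subset[OF assms] by simp
  ultimately show ?thesis
    unfolding normal_inv_iff
  proof (intro conjI ballI)
    fix x h assume x: "x \<in> carrier G" and h: "h \<in> N"
    then have "h \<in> carrier G" "h \<otimes> x = x \<otimes> h"
      using \<open>N \<subseteq> group_center G\<close> by (auto simp: group_center_def)
    then have "x \<otimes> h \<otimes> inv x = h" using x by (simp add: inv_solve_right')
    then show "x \<otimes> h \<otimes> inv x \<in> N" using h by simp
  qed
qed

lemma (in group) derived_eqI:
  assumes Z: "subgroup Z G"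
    and comm: "\<And>x y. x \<in> carrier G \<Longrightarrow> y \<in> carrier G \<Longrightarrow> \<exists>z\<in>Z. x \<otimes> y = z \<otimes> (y \<otimes> x)"
    and surj: "\<And>z. z \<in> Z \<Longrightarrow> \<exists>x\<in>carrier G. \<exists>y\<in>carrier G. x \<otimes> y = z \<otimes> (y \<otimes> x)"
  shows "derived G (carrier G) = Z"
proof -
  have eq: "x \<otimes> y \<otimes> inv x \<otimes> inv y = z"
    if "x \<in> carrier G" "y \<in> carrier G" "z \<in> Z" "x \<otimes> y = z \<otimes> (y \<otimes> x)" for x y z
  proof -
    have "z \<in> carrier G" using subgroup.mem_carrier[OF Z that(3)] .
    then have "z \<otimes> (y \<otimes> x) \<otimes> inv x \<otimes> inv y = z" using that(1,2) by (simp add: inv_solve_right' m_assoc)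
    then show ?thesis using that(4) by simp
  qed
  have "derived_set G (carrier G) = Z"
  proof (intro equalityI subsetI)
    fix w assume "w \<in> derived_set G (carrier G)"
    then obtain x y where "x \<in> carrier G" "y \<in> carrier G" "w = x \<otimes> y \<otimes> inv x \<otimes> inv y" by blast
    with comm eq show "w \<in> Z" by metis
  next
    fix z assume "z \<in> Z"
    with surj obtain x y where xy: "x \<in> carrier G" "y \<in> carrier G" "x \<otimes> y = z \<otimes> (y \<otimes> x)"
      by blast
    then have "z = x \<otimes> y \<otimes> inv x \<otimes> inv y" using eq \<open>z \<in> Z\<close> by simp
    with xy show "z \<in> derived_set G (carrier G)" by blast
  qed
  then show ?thesis
    unfolding derived_def using generateI[OF Z] by (metis subset_refl)
qed

lemma (in group) semi_extraspecialI:
  assumes pgroup: "finite_p_group p G"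
    and comm: "\<And>x y. x \<in> carrier G \<Longrightarrow> y \<in> carrier G \<Longrightarrow>
      \<exists>z\<in>group_center G. x \<otimes> y = z \<otimes> (y \<otimes> x)"
    and pow: "\<And>x. x \<in> carrier G \<Longrightarrow> x [^] p \<in> group_center G"
    and surj: "\<And>x z. x \<in> carrier G - group_center G \<Longrightarrow> z \<in> group_center G \<Longrightarrow>
      \<exists>y\<in>carrier G. x \<otimes> y = z \<otimes> (y \<otimes> x)"
    and nonabelian: "group_center G \<noteq> carrier G"
  shows "semi_extraspecial p G"
proof -
  let ?Z = "group_center G"
  have p: "Factorial_Ring.prime p" using pgroup by (simp add: finite_p_group_def)
  have Zsub: "?Z \<subseteq> carrier G" by (auto simp: group_center_def)
  obtain g where g: "g \<in> carrier G - ?Z" using nonabelian Zsub by blast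
  have "extraspecial p (G Mod N)"
    if N: "subgroup N (G\<lparr>carrier := ?Z\<rparr>)"
      and idx: "card (rcosets\<^bsub>G\<lparr>carrier := ?Z\<rparr>\<^esub> N) = p" for N
  proof -
    interpret N: normal N G using subgroup_center_normal[OF N] .
    define H where "H = G Mod N"
    interpret H: group H unfolding H_def by (rule N.factorgroup_is_group)
    let ?q = "\<lambda>x. N #> x"
    have NZ: "N \<subseteq> ?Z" using subgroup.subset[OF N] by simp
    have carH: "carrier H = ?q ` carrier G" unfolding H_def by (rule carrier_FactGroup)
    have mult: "?q x \<otimes>\<^bsub>H\<^esub> ?q y = ?q (x \<otimes> y)"
      if "x \<in> carrier G" "y \<in> carrier G" for x y
      unfolding H_def using that by (simp add: N.rcos_sum)
    have qeq: "?q x = ?q y \<longleftrightarrow> (\<exists>h\<in>N. x = h \<otimes> y)"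
      if "x \<in> carrier G" "y \<in> carrier G" for x y
    proof -
      have "?q x = ?q y \<longleftrightarrow> x \<in> ?q y"
        using that N.subgroup_axioms repr_independence rcos_self by metis
      then show ?thesis by (auto simp: r_coset_def)
    qed
    have rc: "rcosets\<^bsub>G\<lparr>carrier := ?Z\<rparr>\<^esub> N = ?q ` ?Z"
      by (auto simp: RCOSETS_def)
    have center: "group_center H = ?q ` ?Z"
    proof (intro equalityI subsetI)
      fix X assume "X \<in> ?q ` ?Z"
      then show "X \<in> group_center H"
        using Zsub by (auto simp: group_center_def carH mult)
    next
      fix X assume X: "X \<in> group_center H"
      then obtain x where x: "x \<in> carrier G" "X = ?q x"
        by (auto simp: group_center_def carH)
      show "X \<in> ?q ` ?Z"
      proof (rule ccontr)
        assume "X \<notin> ?q ` ?Z"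
        then have xZ: "x \<in> carrier G - ?Z" using x by auto
        have "z \<in> N" if z: "z \<in> ?Z" for z
        proof -
          from surj[OF xZ z] obtain y where y: "y \<in> carrier G" "x \<otimes> y = z \<otimes> (y \<otimes> x)" by blast
          have "?q y \<in> carrier H" using y carH by blast
          then have "?q (x \<otimes> y) = ?q (y \<otimes> x)"
            using X x y mult by (auto simp: group_center_def)
          then obtain h where h: "h \<in> N" "x \<otimes> y = h \<otimes> (y \<otimes> x)"
            using qeq x y by (meson m_closed)
          then have "z = h" using x y z Zsub N.subset by (metis m_closed right_cancel subsetD)
          with h show ?thesis by simp
        qed
        then have "?Z = N" using NZ by blast
        then have "?q ` ?Z = {N}" using N.subgroup_axioms
          by (metis (mono_tags, lifting) N.rcos_const N.one_closed
              image_cong image_constant is_group)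
        then show False using idx rc p by (simp add: prime_nat_iff)
      qed
    qed
    have fpH: "finite_p_group p H"
    proof -
      obtain k where k: "order G = p ^ k" using pgroup by (auto simp: finite_p_group_def)
      have "order H * card N = order G"
        unfolding H_def order_def using lagrange[OF N.subgroup_axioms]
        by (simp add: FactGroup_def order_def)
      then have "order H dvd p ^ k" using k by (metis dvd_triv_left)
      then show ?thesis
        using p H.group_axioms divides_primepow_nat[OF p] by (auto simp: finite_p_group_def)
    qed
    have commH: "\<exists>z\<in>group_center H. X \<otimes>\<^bsub>H\<^esub> Y = z \<otimes>\<^bsub>H\<^esub> (Y \<otimes>\<^bsub>H\<^esub> X)"
      if XY: "X \<in> carrier H" "Y \<in> carrier H" for X Y
    proof -
      obtain x y where xy: "x \<in> carrier G" "y \<in> carrier G" "X = ?q x" "Y = ?q y"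
        using XY carH by auto
      with comm obtain z where "z \<in> ?Z" "x \<otimes> y = z \<otimes> (y \<otimes> x)" by blast
      then have "X \<otimes>\<^bsub>H\<^esub> Y = ?q z \<otimes>\<^bsub>H\<^esub> (Y \<otimes>\<^bsub>H\<^esub> X)" "?q z \<in> group_center H"
        using xy Zsub center by (auto simp: mult subset_iff)
      then show ?thesis by blast
    qed
    have der: "derived H (carrier H) = group_center H"
    proof (rule H.derived_eqI[OF H.group_center_subgroup commH])
      fix X assume "X \<in> group_center H"
      then obtain z where z: "z \<in> ?Z" "X = ?q z" using center by auto
      then obtain y where "y \<in> carrier G" "g \<otimes> y = z \<otimes> (y \<otimes> g)" using surj g by blast
      then have "?q g \<otimes>\<^bsub>H\<^esub> ?q y = X \<otimes>\<^bsub>H\<^esub> (?q y \<otimes>\<^bsub>H\<^esub> ?q g)" "?q g \<in> carrier H" "?q y \<in> carrier H"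
        using g z Zsub by (auto simp: mult carH subset_iff)
      then show "\<exists>x\<in>carrier H. \<exists>y\<in>carrier H. x \<otimes>\<^bsub>H\<^esub> y = X \<otimes>\<^bsub>H\<^esub> (y \<otimes>\<^bsub>H\<^esub> x)" by blast
    qed
    interpret ZH: normal "group_center H" H
      by (rule H.subgroup_center_normal)
         (use group.subgroup_self[OF H.subgroup_imp_group[OF H.group_center_subgroup]] in simp)
    have "elementary_abelian p (H Mod group_center H)"
      unfolding elementary_abelian_def
    proof (intro conjI ballI p)
      show "comm_group (H Mod group_center H)"
      proof (rule group.group_comm_groupI[OF ZH.factorgroup_is_group])
        fix A B assume "A \<in> carrier (H Mod group_center H)" "B \<in> carrier (H Mod group_center H)"
        then obtain X Y where XY: "X \<in> carrier H" "Y \<in> carrier H"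
          "A = group_center H #>\<^bsub>H\<^esub> X" "B = group_center H #>\<^bsub>H\<^esub> Y"
          by (auto simp: carrier_FactGroup)
        then obtain z where "z \<in> group_center H" "X \<otimes>\<^bsub>H\<^esub> Y = z \<otimes>\<^bsub>H\<^esub> (Y \<otimes>\<^bsub>H\<^esub> X)"
          using commH by blast
        then have "X \<otimes>\<^bsub>H\<^esub> Y \<in> group_center H #>\<^bsub>H\<^esub> (Y \<otimes>\<^bsub>H\<^esub> X)"
          by (auto simp: r_coset_def)
        then have "group_center H #>\<^bsub>H\<^esub> (Y \<otimes>\<^bsub>H\<^esub> X) = group_center H #>\<^bsub>H\<^esub> (X \<otimes>\<^bsub>H\<^esub> Y)"
          using H.repr_independence XY ZH.subgroup_axioms by (metis H.m_closed)
        then show "A \<otimes>\<^bsub>H Mod group_center H\<^esub> B = B \<otimes>\<^bsub>H Mod group_center H\<^esub> A"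
          using XY by (simp add: ZH.rcos_sum)
      qed
    next
      fix A assume "A \<in> carrier (H Mod group_center H)"
      then obtain x where x: "x \<in> carrier G" "A = group_center H #>\<^bsub>H\<^esub> ?q x"
        by (auto simp: carrier_FactGroup carH)
      have "?q x [^]\<^bsub>H\<^esub> p = ?q (x [^] p)"
        unfolding H_def using N.FactGroup_pow x by blast
      then have "?q x [^]\<^bsub>H\<^esub> p \<in> group_center H" using pow x center by auto
      moreover have "A [^]\<^bsub>H Mod group_center H\<^esub> p = group_center H #>\<^bsub>H\<^esub> (?q x [^]\<^bsub>H\<^esub> p)"
        using ZH.FactGroup_pow x carH by blast
      ultimately show "A [^]\<^bsub>H Mod group_center H\<^esub> p = \<one>\<^bsub>H Mod group_center H\<^esub>"
        using ZH.rcos_const[OF H.group_axioms] by simp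
    qed
    then have "extraspecial p H"
      unfolding extraspecial_def using fpH der center idx rc by simp
    then show ?thesis unfolding H_def .
  qed
  then show ?thesis unfolding semi_extraspecial_def using pgroup by blast
qed

lemma (in abelian_group) neg_zero [simp]: "\<ominus> \<zero> = \<zero>"
  by (rule minus_equality) simp_all

locale biadditive_map = V: abelian_group V + W: abelian_group W
  for V :: "('v, 'k) ring_scheme" (structure) and W :: "('w, 'l) ring_scheme" (structure) +
  fixes \<gamma> :: "'v \<Rightarrow> 'v \<Rightarrow> 'w"
  assumes biadd: "biadditive V W \<gamma>"
begin

lemma closed [simp, intro]: "u \<in> carrier V \<Longrightarrow> v \<in> carrier V \<Longrightarrow> \<gamma> u v \<in> carrier W"
  using biadd by (auto simp: biadditive_def hom_def)

lemma add_left [simp]: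
  "u \<in> carrier V \<Longrightarrow> u' \<in> carrier V \<Longrightarrow> v \<in> carrier V \<Longrightarrow>
    \<gamma> (u \<oplus>\<^bsub>V\<^esub> u') v = \<gamma> u v \<oplus>\<^bsub>W\<^esub> \<gamma> u' v"
  using biadd by (simp add: biadditive_def hom_def)

lemma add_right [simp]:
  "u \<in> carrier V \<Longrightarrow> v \<in> carrier V \<Longrightarrow> v' \<in> carrier V \<Longrightarrow>
    \<gamma> u (v \<oplus>\<^bsub>V\<^esub> v') = \<gamma> u v \<oplus>\<^bsub>W\<^esub> \<gamma> u v'"
  using biadd by (simp add: biadditive_def hom_def)

lemma zero_left [simp]: "v \<in> carrier V \<Longrightarrow> \<gamma> \<zero>\<^bsub>V\<^esub> v = \<zero>\<^bsub>W\<^esub>"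
  using add_left[of "\<zero>\<^bsub>V\<^esub>" "\<zero>\<^bsub>V\<^esub>" v] by (simp del: add_left)

lemma zero_right [simp]: "v \<in> carrier V \<Longrightarrow> \<gamma> v \<zero>\<^bsub>V\<^esub> = \<zero>\<^bsub>W\<^esub>"
  using add_right[of v "\<zero>\<^bsub>V\<^esub>" "\<zero>\<^bsub>V\<^esub>"] by (simp del: add_right)

lemma neg_left [simp]:
  assumes "u \<in> carrier V" "v \<in> carrier V" shows "\<gamma> (\<ominus>\<^bsub>V\<^esub> u) v = \<ominus>\<^bsub>W\<^esub> \<gamma> u v"
  using assms add_left[of "\<ominus>\<^bsub>V\<^esub> u" u v]
  by (intro W.minus_equality[symmetric]) (simp_all add: V.l_neg del: add_left)

lemma neg_right [simp]:
  assumes "u \<in> carrier V" "v \<in> carrier V" shows "\<gamma> u (\<ominus>\<^bsub>V\<^esub> v) = \<ominus>\<^bsub>W\<^esub> \<gamma> u v"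
  using assms add_right[of u "\<ominus>\<^bsub>V\<^esub> v" v]
  by (intro W.minus_equality[symmetric]) (simp_all add: V.l_neg del: add_right)

lemma pow_left:
  assumes "u \<in> carrier V" "v \<in> carrier V"
  shows "\<gamma> ([k] \<cdot>\<^bsub>V\<^esub> u) v = [(k::nat)] \<cdot>\<^bsub>W\<^esub> \<gamma> u v"
  using assms by (induction k) auto

lemma skew_closed [simp, intro]:
  "u \<in> carrier V \<Longrightarrow> v \<in> carrier V \<Longrightarrow> skew_part W \<gamma> u v \<in> carrier W"
  by (simp add: skew_part_def)

lemma skew_eq_zero_iff:
  "u \<in> carrier V \<Longrightarrow> v \<in> carrier V \<Longrightarrow> skew_part W \<gamma> u v = \<zero>\<^bsub>W\<^esub> \<longleftrightarrow> \<gamma> u v = \<gamma> v u"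
  by (simp add: skew_part_def W.minus_eq W.add.inv_solve_right')

end

locale twisted = A: biadditive_map V W \<alpha> + B: biadditive_map V W \<beta>
  for V :: "('v, 'k) ring_scheme" (structure) and W :: "('w, 'l) ring_scheme" (structure)
    and \<alpha> \<beta> :: "'v \<Rightarrow> 'v \<Rightarrow> 'w"
begin

abbreviation G where "G \<equiv> twisted_group V W \<alpha> \<beta>"

abbreviation comm_term :: "'v \<Rightarrow> 'v \<Rightarrow> 'v \<Rightarrow> 'v \<Rightarrow> 'w" where
  "comm_term a\<^sub>1 b\<^sub>1 a\<^sub>2 b\<^sub>2 \<equiv> \<alpha> a\<^sub>1 b\<^sub>2 \<ominus>\<^bsub>W\<^esub> \<alpha> a\<^sub>2 b\<^sub>1 \<oplus>\<^bsub>W\<^esub> skew_part W \<beta> b\<^sub>1 b\<^sub>2"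

lemma carrier_G: "carrier G = carrier V \<times> carrier V \<times> carrier W"
  by (simp add: twisted_group_def)

lemma one_G: "\<one>\<^bsub>G\<^esub> = (\<zero>\<^bsub>V\<^esub>, \<zero>\<^bsub>V\<^esub>, \<zero>\<^bsub>W\<^esub>)"
  by (simp add: twisted_group_def)

lemma mult_G: "(a\<^sub>1, b\<^sub>1, c\<^sub>1) \<otimes>\<^bsub>G\<^esub> (a\<^sub>2, b\<^sub>2, c\<^sub>2) =
    (a\<^sub>1 \<oplus>\<^bsub>V\<^esub> a\<^sub>2, b\<^sub>1 \<oplus>\<^bsub>V\<^esub> b\<^sub>2, c\<^sub>1 \<oplus>\<^bsub>W\<^esub> c\<^sub>2 \<oplus>\<^bsub>W\<^esub> \<alpha> a\<^sub>1 b\<^sub>2 \<oplus>\<^bsub>W\<^esub> \<beta> b\<^sub>1 b\<^sub>2)"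
  by (simp add: twisted_group_def)

lemma mult_inverse_G:
  assumes "a \<in> carrier V" "b \<in> carrier V" "c \<in> carrier W"
  shows "(\<ominus>\<^bsub>V\<^esub> a, \<ominus>\<^bsub>V\<^esub> b, \<alpha> a b \<oplus>\<^bsub>W\<^esub> \<beta> b b \<ominus>\<^bsub>W\<^esub> c) \<otimes>\<^bsub>G\<^esub> (a, b, c) = \<one>\<^bsub>G\<^esub>"
proof -
  have "\<alpha> a b \<oplus>\<^bsub>W\<^esub> \<beta> b b \<ominus>\<^bsub>W\<^esub> c \<oplus>\<^bsub>W\<^esub> c \<oplus>\<^bsub>W\<^esub> \<ominus>\<^bsub>W\<^esub> \<alpha> a b \<oplus>\<^bsub>W\<^esub> \<ominus>\<^bsub>W\<^esub> \<beta> b b =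
      (\<alpha> a b \<oplus>\<^bsub>W\<^esub> \<ominus>\<^bsub>W\<^esub> \<alpha> a b) \<oplus>\<^bsub>W\<^esub> (\<beta> b b \<oplus>\<^bsub>W\<^esub> \<ominus>\<^bsub>W\<^esub> \<beta> b b) \<oplus>\<^bsub>W\<^esub> (c \<oplus>\<^bsub>W\<^esub> \<ominus>\<^bsub>W\<^esub> c)"
    using assms by (simp add: A.W.minus_eq A.W.a_ac)
  also have "\<dots> = \<zero>\<^bsub>W\<^esub>" using assms by (simp add: A.W.r_neg)
  finally show ?thesis using assms by (simp add: mult_G one_G A.V.l_neg)
qed

sublocale G: group G
proof (rule groupI)
  fix x assume "x \<in> carrier G"
  then obtain a b c where x: "x = (a, b, c)" "a \<in> carrier V" "b \<in> carrier V" "c \<in> carrier W"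
    by (auto simp: carrier_G)
  then have "(\<ominus>\<^bsub>V\<^esub> a, \<ominus>\<^bsub>V\<^esub> b, \<alpha> a b \<oplus>\<^bsub>W\<^esub> \<beta> b b \<ominus>\<^bsub>W\<^esub> c) \<in> carrier G"
    by (simp add: carrier_G)
  with x mult_inverse_G show "\<exists>y\<in>carrier G. y \<otimes>\<^bsub>G\<^esub> x = \<one>\<^bsub>G\<^esub>" by blast
next
  fix x y z assume "x \<in> carrier G" "y \<in> carrier G" "z \<in> carrier G"
  then show "x \<otimes>\<^bsub>G\<^esub> y \<otimes>\<^bsub>G\<^esub> z = x \<otimes>\<^bsub>G\<^esub> (y \<otimes>\<^bsub>G\<^esub> z)"
    by (auto simp: carrier_G mult_G A.V.a_assoc A.W.a_ac)
qed (auto simp: carrier_G one_G mult_G)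

lemma inv_G:
  assumes "a \<in> carrier V" "b \<in> carrier V" "c \<in> carrier W"
  shows "inv\<^bsub>G\<^esub> (a, b, c) = (\<ominus>\<^bsub>V\<^esub> a, \<ominus>\<^bsub>V\<^esub> b, \<alpha> a b \<oplus>\<^bsub>W\<^esub> \<beta> b b \<ominus>\<^bsub>W\<^esub> c)"
  using assms by (intro G.inv_equality mult_inverse_G) (auto simp: carrier_G)

lemma mult_swap:
  assumes "a\<^sub>1 \<in> carrier V" "b\<^sub>1 \<in> carrier V" "c\<^sub>1 \<in> carrier W"
    "a\<^sub>2 \<in> carrier V" "b\<^sub>2 \<in> carrier V" "c\<^sub>2 \<in> carrier W"
  shows "(a\<^sub>1, b\<^sub>1, c\<^sub>1) \<otimes>\<^bsub>G\<^esub> (a\<^sub>2, b\<^sub>2, c\<^sub>2) =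
    (\<zero>\<^bsub>V\<^esub>, \<zero>\<^bsub>V\<^esub>, comm_term a\<^sub>1 b\<^sub>1 a\<^sub>2 b\<^sub>2) \<otimes>\<^bsub>G\<^esub> ((a\<^sub>2, b\<^sub>2, c\<^sub>2) \<otimes>\<^bsub>G\<^esub> (a\<^sub>1, b\<^sub>1, c\<^sub>1))"
proof -
  have "comm_term a\<^sub>1 b\<^sub>1 a\<^sub>2 b\<^sub>2 \<oplus>\<^bsub>W\<^esub> (c\<^sub>2 \<oplus>\<^bsub>W\<^esub> c\<^sub>1 \<oplus>\<^bsub>W\<^esub> \<alpha> a\<^sub>2 b\<^sub>1 \<oplus>\<^bsub>W\<^esub> \<beta> b\<^sub>2 b\<^sub>1) =
    c\<^sub>1 \<oplus>\<^bsub>W\<^esub> c\<^sub>2 \<oplus>\<^bsub>W\<^esub> \<alpha> a\<^sub>1 b\<^sub>2 \<oplus>\<^bsub>W\<^esub> \<beta> b\<^sub>1 b\<^sub>2 \<oplus>\<^bsub>W\<^esub> (\<alpha> a\<^sub>2 b\<^sub>1 \<oplus>\<^bsub>W\<^esub> \<ominus>\<^bsub>W\<^esub> \<alpha> a\<^sub>2 b\<^sub>1) \<oplus>\<^bsub>W\<^esub> (\<beta> b\<^sub>2 b\<^sub>1 \<oplus>\<^bsub>W\<^esub> \<ominus>\<^bsub>W\<^esub> \<beta> b\<^sub>2 b\<^sub>1)"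
    using assms by (simp add: skew_part_def A.W.minus_eq A.W.a_ac)
  also have "\<dots> = c\<^sub>1 \<oplus>\<^bsub>W\<^esub> c\<^sub>2 \<oplus>\<^bsub>W\<^esub> \<alpha> a\<^sub>1 b\<^sub>2 \<oplus>\<^bsub>W\<^esub> \<beta> b\<^sub>1 b\<^sub>2"
    using assms by (simp add: A.W.r_neg)
  finally show ?thesis using assms by (simp add: mult_G A.V.a_ac)
qed

lemma commutator_G:
  assumes "a\<^sub>1 \<in> carrier V" "b\<^sub>1 \<in> carrier V" "c\<^sub>1 \<in> carrier W"
    "a\<^sub>2 \<in> carrier V" "b\<^sub>2 \<in> carrier V" "c\<^sub>2 \<in> carrier W"
  shows "commutator G (a\<^sub>1, b\<^sub>1, c\<^sub>1) (a\<^sub>2, b\<^sub>2, c\<^sub>2) = (\<zero>\<^bsub>V\<^esub>, \<zero>\<^bsub>V\<^esub>, comm_term a\<^sub>1 b\<^sub>1 a\<^sub>2 b\<^sub>2)"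
proof -
  define x where "x = (a\<^sub>1, b\<^sub>1, c\<^sub>1)"
  define y where "y = (a\<^sub>2, b\<^sub>2, c\<^sub>2)"
  define z where "z = (\<zero>\<^bsub>V\<^esub>, \<zero>\<^bsub>V\<^esub>, comm_term a\<^sub>1 b\<^sub>1 a\<^sub>2 b\<^sub>2)"
  have car: "x \<in> carrier G" "y \<in> carrier G" "z \<in> carrier G"
    using assms by (auto simp: x_def y_def z_def carrier_G)
  have "z \<otimes>\<^bsub>G\<^esub> (y \<otimes>\<^bsub>G\<^esub> x) = (y \<otimes>\<^bsub>G\<^esub> x) \<otimes>\<^bsub>G\<^esub> z"
    using assms by (simp add: x_def y_def z_def mult_G A.W.a_ac)
  then have eq: "x \<otimes>\<^bsub>G\<^esub> y = y \<otimes>\<^bsub>G\<^esub> x \<otimes>\<^bsub>G\<^esub> z"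
    using mult_swap[OF assms] by (simp add: x_def y_def z_def)
  have "commutator G x y = inv\<^bsub>G\<^esub> (y \<otimes>\<^bsub>G\<^esub> x) \<otimes>\<^bsub>G\<^esub> (x \<otimes>\<^bsub>G\<^esub> y)"
    using car by (simp add: commutator_def G.inv_mult_group G.m_assoc)
  also have "\<dots> = z"
    using car by (subst eq) (simp add: G.inv_solve_left' G.m_assoc)
  finally show ?thesis by (simp add: x_def y_def z_def)
qed

lemma commute_iff:
  assumes "a\<^sub>1 \<in> carrier V" "b\<^sub>1 \<in> carrier V" "c\<^sub>1 \<in> carrier W"
    "a\<^sub>2 \<in> carrier V" "b\<^sub>2 \<in> carrier V" "c\<^sub>2 \<in> carrier W"
  shows "(a\<^sub>1, b\<^sub>1, c\<^sub>1) \<otimes>\<^bsub>G\<^esub> (a\<^sub>2, b\<^sub>2, c\<^sub>2) = (a\<^sub>2, b\<^sub>2, c\<^sub>2) \<otimes>\<^bsub>G\<^esub> (a\<^sub>1, b\<^sub>1, c\<^sub>1) \<longleftrightarrow>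
    comm_term a\<^sub>1 b\<^sub>1 a\<^sub>2 b\<^sub>2 = \<zero>\<^bsub>W\<^esub>"
proof -
  let ?y = "(a\<^sub>2, b\<^sub>2, c\<^sub>2) \<otimes>\<^bsub>G\<^esub> (a\<^sub>1, b\<^sub>1, c\<^sub>1)" and ?z = "(\<zero>\<^bsub>V\<^esub>, \<zero>\<^bsub>V\<^esub>, comm_term a\<^sub>1 b\<^sub>1 a\<^sub>2 b\<^sub>2)"
  have "?y \<in> carrier G" "?z \<in> carrier G"
    using assms by (auto simp: carrier_G mult_G)
  then have "?z \<otimes>\<^bsub>G\<^esub> ?y = ?y \<longleftrightarrow> ?z = \<one>\<^bsub>G\<^esub>" by (rule G.r_cancel_one)
  then show ?thesis using mult_swap[OF assms] by (simp add: one_G)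
qed

lemma pow_G:
  assumes "a \<in> carrier V" "b \<in> carrier V" "c \<in> carrier W"
  shows "(a, b, c) [^]\<^bsub>G\<^esub> (k::nat) =
    ([k] \<cdot>\<^bsub>V\<^esub> a, [k] \<cdot>\<^bsub>V\<^esub> b, [k] \<cdot>\<^bsub>W\<^esub> c \<oplus>\<^bsub>W\<^esub> [(k choose 2)] \<cdot>\<^bsub>W\<^esub> (\<alpha> a b \<oplus>\<^bsub>W\<^esub> \<beta> b b))"
proof (induction k)
  case (Suc k)
  have "[(Suc k choose 2)] \<cdot>\<^bsub>W\<^esub> (\<alpha> a b \<oplus>\<^bsub>W\<^esub> \<beta> b b) =
    [(k choose 2)] \<cdot>\<^bsub>W\<^esub> (\<alpha> a b \<oplus>\<^bsub>W\<^esub> \<beta> b b) \<oplus>\<^bsub>W\<^esub> [k] \<cdot>\<^bsub>W\<^esub> (\<alpha> a b \<oplus>\<^bsub>W\<^esub> \<beta> b b)"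
    using assms by (simp add: numeral_2_eq_2 A.W.add.nat_pow_mult add.commute)
  also have "[k] \<cdot>\<^bsub>W\<^esub> (\<alpha> a b \<oplus>\<^bsub>W\<^esub> \<beta> b b) = \<alpha> ([k] \<cdot>\<^bsub>V\<^esub> a) b \<oplus>\<^bsub>W\<^esub> \<beta> ([k] \<cdot>\<^bsub>V\<^esub> b) b"
    using assms by (simp add: A.pow_left B.pow_left A.W.add.nat_pow_distrib)
  finally show ?case
    using Suc assms by (simp add: mult_G A.W.a_ac)
next
  case 0
  then show ?case using assms by (simp add: one_G numeral_2_eq_2)
qed

end

locale nonsingular_twisted = twisted +
  assumes nonsingular: "generalized_nonsingular V W \<alpha>"
begin

lemma nonsingular_surj:
  assumes "v \<in> carrier V" "v \<noteq> \<zero>\<^bsub>V\<^esub>" "w \<in> carrier W"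
  shows "\<exists>u\<in>carrier V. \<alpha> v u = w" "\<exists>u\<in>carrier V. \<alpha> u v = w"
proof -
  have "{\<alpha> v u | u. u \<in> carrier V} = carrier W" "{\<alpha> u v | u. u \<in> carrier V} = carrier W"
    using nonsingular assms(1,2) unfolding generalized_nonsingular_def by blast+
  then have "w \<in> {\<alpha> v u | u. u \<in> carrier V}" "w \<in> {\<alpha> u v | u. u \<in> carrier V}"
    using assms(3) by simp_all
  then show "\<exists>u\<in>carrier V. \<alpha> v u = w" and "\<exists>u\<in>carrier V. \<alpha> u v = w"
    by auto
qed

lemma comm_term_surj:
  assumes "a \<in> carrier V" "b \<in> carrier V" "(a, b) \<noteq> (\<zero>\<^bsub>V\<^esub>, \<zero>\<^bsub>V\<^esub>)" "w \<in> carrier W"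
  shows "\<exists>a'\<in>carrier V. \<exists>b'\<in>carrier V. comm_term a b a' b' = w"
proof (cases "b = \<zero>\<^bsub>V\<^esub>")
  case True
  then obtain u where "u \<in> carrier V" "\<alpha> a u = w"
    using nonsingular_surj(1) assms by blast
  then have "comm_term a b \<zero>\<^bsub>V\<^esub> u = w"
    using assms True by (simp add: skew_part_def A.W.minus_eq)
  then show ?thesis using \<open>u \<in> carrier V\<close> by blast
next
  case False
  then obtain u where u: "u \<in> carrier V" "\<alpha> u b = \<ominus>\<^bsub>W\<^esub> w"
    using nonsingular_surj(2) assms by blast
  then have "comm_term a b u \<zero>\<^bsub>V\<^esub> = w"
    using assms by (simp add: skew_part_def A.W.minus_eq)
  then show ?thesis using u(1) by blast
qed

lemma center_G:
  assumes "carrier W \<noteq> {\<zero>\<^bsub>W\<^esub>}"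
  shows "group_center G = {(\<zero>\<^bsub>V\<^esub>, \<zero>\<^bsub>V\<^esub>, c) | c. c \<in> carrier W}"
proof (intro equalityI subsetI)
  fix x assume x: "x \<in> group_center G"
  then obtain a b c where abc: "x = (a, b, c)" "a \<in> carrier V" "b \<in> carrier V" "c \<in> carrier W"
    by (auto simp: group_center_def carrier_G)
  obtain w where w: "w \<in> carrier W" "w \<noteq> \<zero>\<^bsub>W\<^esub>" using assms by blast
  have "(a, b) = (\<zero>\<^bsub>V\<^esub>, \<zero>\<^bsub>V\<^esub>)"
  proof (rule ccontr)
    assume "(a, b) \<noteq> (\<zero>\<^bsub>V\<^esub>, \<zero>\<^bsub>V\<^esub>)"
    then obtain a' b' where ab: "a' \<in> carrier V" "b' \<in> carrier V" "comm_term a b a' b' = w"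
      using comm_term_surj abc w by meson
    then have "(a', b', \<zero>\<^bsub>W\<^esub>) \<in> carrier G" by (simp add: carrier_G)
    with x have "x \<otimes>\<^bsub>G\<^esub> (a', b', \<zero>\<^bsub>W\<^esub>) = (a', b', \<zero>\<^bsub>W\<^esub>) \<otimes>\<^bsub>G\<^esub> x"
      by (simp add: group_center_def)
    then show False using commute_iff[of a b c a' b' "\<zero>\<^bsub>W\<^esub>"] abc ab w by auto
  qed
  with abc show "x \<in> {(\<zero>\<^bsub>V\<^esub>, \<zero>\<^bsub>V\<^esub>, c) | c. c \<in> carrier W}" by simp
next
  fix x assume "x \<in> {(\<zero>\<^bsub>V\<^esub>, \<zero>\<^bsub>V\<^esub>, c) | c. c \<in> carrier W}"
  then show "x \<in> group_center G"
    by (auto simp: group_center_def carrier_G mult_G A.W.a_ac)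
qed

lemma commutators_surj:
  assumes "carrier W \<noteq> {\<zero>\<^bsub>W\<^esub>}" "x \<in> carrier G - group_center G" "z \<in> group_center G"
  shows "\<exists>y\<in>carrier G. x \<otimes>\<^bsub>G\<^esub> y = z \<otimes>\<^bsub>G\<^esub> (y \<otimes>\<^bsub>G\<^esub> x)"
proof -
  obtain a b c w where x: "x = (a, b, c)" "a \<in> carrier V" "b \<in> carrier V" "c \<in> carrier W"
    and z: "z = (\<zero>\<^bsub>V\<^esub>, \<zero>\<^bsub>V\<^esub>, w)" "w \<in> carrier W"
    using assms unfolding center_G[OF assms(1)] carrier_G by blast
  have "(a, b) \<noteq> (\<zero>\<^bsub>V\<^esub>, \<zero>\<^bsub>V\<^esub>)"
    using assms(2) x unfolding center_G[OF assms(1)] by blast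
  then obtain a' b' where ab: "a' \<in> carrier V" "b' \<in> carrier V" "comm_term a b a' b' = w"
    using comm_term_surj x z by meson
  have "x \<otimes>\<^bsub>G\<^esub> (a', b', \<zero>\<^bsub>W\<^esub>) = z \<otimes>\<^bsub>G\<^esub> ((a', b', \<zero>\<^bsub>W\<^esub>) \<otimes>\<^bsub>G\<^esub> x)"
    using mult_swap[of a b c a' b' "\<zero>\<^bsub>W\<^esub>"] x z ab by simp
  moreover have "(a', b', \<zero>\<^bsub>W\<^esub>) \<in> carrier G" using ab by (simp add: carrier_G)
  ultimately show ?thesis by blast
qed

lemma commutators_central:
  assumes "carrier W \<noteq> {\<zero>\<^bsub>W\<^esub>}" "x \<in> carrier G" "y \<in> carrier G"
  shows "\<exists>z\<in>group_center G. x \<otimes>\<^bsub>G\<^esub> y = z \<otimes>\<^bsub>G\<^esub> (y \<otimes>\<^bsub>G\<^esub> x)"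
proof -
  obtain a b c a' b' c' where *: "x = (a, b, c)" "y = (a', b', c')" "a \<in> carrier V" "b \<in> carrier V"
    "c \<in> carrier W" "a' \<in> carrier V" "b' \<in> carrier V" "c' \<in> carrier W"
    using assms(2,3) unfolding carrier_G by blast
  then have "(\<zero>\<^bsub>V\<^esub>, \<zero>\<^bsub>V\<^esub>, comm_term a b a' b') \<in> group_center G"
    unfolding center_G[OF assms(1)] by blast
  then show ?thesis using mult_swap[of a b c a' b' c'] * by blast
qed

lemma derived_G:
  assumes "carrier W \<noteq> {\<zero>\<^bsub>W\<^esub>}" "group_center G \<noteq> carrier G"
  shows "derived G (carrier G) = group_center G"
proof (rule G.derived_eqI[OF G.group_center_subgroup commutators_central[OF assms(1)]])
  obtain x where x: "x \<in> carrier G - group_center G"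
    using assms(2) by (auto simp: group_center_def)
  fix z assume "z \<in> group_center G"
  with commutators_surj[OF assms(1) x] x
  show "\<exists>x\<in>carrier G. \<exists>y\<in>carrier G. x \<otimes>\<^bsub>G\<^esub> y = z \<otimes>\<^bsub>G\<^esub> (y \<otimes>\<^bsub>G\<^esub> x)" by blast
qed

end

theorem theorem3p1:
  fixes p m n :: nat
    and V :: "('v, 'k) ring_scheme" and W :: "('w, 'l) ring_scheme"
    and \<alpha> \<beta> :: "'v \<Rightarrow> 'v \<Rightarrow> 'w"
    and G :: "('v \<times> 'v \<times> 'w) monoid"
    and A B :: "('v \<times> 'v \<times> 'w) set"
  assumes "Factorial_Ring.prime p" and "0 < m" and "m \<le> n"
    and "abelian_group V" and "elementary_abelian p (add_monoid V)" and "card (carrier V) = p ^ n"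
    and "abelian_group W" and "elementary_abelian p (add_monoid W)" and "card (carrier W) = p ^ m"
    and "generalized_nonsingular V W \<alpha>" and "biadditive V W \<beta>"
  defines "G \<equiv> twisted_group V W \<alpha> \<beta>"
    and "A \<equiv> {(a, \<zero>\<^bsub>V\<^esub>, c) | a c. a \<in> carrier V \<and> c \<in> carrier W}"
    and "B \<equiv> {(\<zero>\<^bsub>V\<^esub>, b, c) | b c. b \<in> carrier V \<and> c \<in> carrier W}"
  shows "(semi_extraspecial p G \<and>
         derived G (carrier G) = group_center G \<and>
         group_center G = {(\<zero>\<^bsub>V\<^esub>, \<zero>\<^bsub>V\<^esub>, c) | c. c \<in> carrier W})
   \<and> (\<forall>a\<^sub>1\<in>carrier V. \<forall>b\<^sub>1\<in>carrier V. \<forall>c\<^sub>1\<in>carrier W.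
         \<forall>a\<^sub>2\<in>carrier V. \<forall>b\<^sub>2\<in>carrier V. \<forall>c\<^sub>2\<in>carrier W.
           commutator G (a\<^sub>1, b\<^sub>1, c\<^sub>1) (a\<^sub>2, b\<^sub>2, c\<^sub>2) =
             (\<zero>\<^bsub>V\<^esub>, \<zero>\<^bsub>V\<^esub>, \<alpha> a\<^sub>1 b\<^sub>2 \<ominus>\<^bsub>W\<^esub> \<alpha> a\<^sub>2 b\<^sub>1 \<oplus>\<^bsub>W\<^esub> skew_part W \<beta> b\<^sub>1 b\<^sub>2))
   \<and> (odd p \<longrightarrow> group_exponent G = p)
   \<and> (subgroup A G \<and> comm_group (G\<lparr>carrier := A\<rparr>) \<and> card A = p ^ (n + m))
   \<and> (subgroup B G \<and> card B = p ^ (n + m))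
   \<and> (carrier G = A <#>\<^bsub>G\<^esub> B \<and> A \<inter> B = derived G (carrier G))
   \<and> (\<forall>v\<in>carrier V - {\<zero>\<^bsub>V\<^esub>}.
           ((\<forall>u\<in>carrier V. skew_part W \<beta> u v = \<zero>\<^bsub>W\<^esub>) \<longleftrightarrow>
            (\<forall>c\<in>carrier W. (\<zero>\<^bsub>V\<^esub>, v, c) \<in> group_center (G\<lparr>carrier := B\<rparr>))) \<and>
           (\<forall>c\<in>carrier W.
              B \<subseteq> centralizer G (\<zero>\<^bsub>V\<^esub>, v, c) \<longleftrightarrow>
              (\<forall>u\<in>carrier V. skew_part W \<beta> u v = \<zero>\<^bsub>W\<^esub>)))
   \<and> ((\<forall>u\<in>carrier V. \<forall>v\<in>carrier V. skew_part W \<beta> u v = \<zero>\<^bsub>W\<^esub>) \<longleftrightarrow>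
         comm_group (G\<lparr>carrier := B\<rparr>))"
proof -
  have G_def: "G = twisted_group V W \<alpha> \<beta>" and A_def: "A = carrier V \<times> {\<zero>\<^bsub>V\<^esub>} \<times> carrier W"
    and B_def: "B = {\<zero>\<^bsub>V\<^esub>} \<times> carrier V \<times> carrier W"
    by (auto simp: G_def A_def B_def)
  interpret V: abelian_group V by fact
  interpret W: abelian_group W by fact
  interpret T: nonsingular_twisted V W \<alpha> \<beta>
    using assms(10,11)
    by unfold_locales (auto simp: generalized_nonsingular_def)
  interpret G: group G unfolding G_def by (rule T.G.group_axioms)
  note carrier_G = T.carrier_G[folded G_def] and mult_G = T.mult_G[folded G_def]
    and one_G = T.one_G[folded G_def] and inv_G = T.inv_G[folded G_def] and pow_G = T.pow_G[folded G_def]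
    and commute_iff = T.commute_iff[folded G_def] and commutator_G = T.commutator_G[folded G_def]
    and center_G = T.center_G[folded G_def] and derived_G = T.derived_G[folded G_def]
    and commutators_central = T.commutators_central[folded G_def]
    and commutators_surj = T.commutators_surj[folded G_def]
  have p: "Factorial_Ring.prime p" by fact
  have p1: "1 < p" using p prime_gt_1_nat by blast
  have pV: "[p] \<cdot>\<^bsub>V\<^esub> v = \<zero>\<^bsub>V\<^esub>" if "v \<in> carrier V" for v
    using assms(5) that by (simp add: elementary_abelian_def add_pow_def)
  have pW: "[p] \<cdot>\<^bsub>W\<^esub> w = \<zero>\<^bsub>W\<^esub>" if "w \<in> carrier W" for w
    using assms(8) that by (simp add: elementary_abelian_def add_pow_def)
  have ntW: "carrier W \<noteq> {\<zero>\<^bsub>W\<^esub>}"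
    using assms(2,9) p1 one_less_power[of p m] by auto
  have ntV: "carrier V \<noteq> {\<zero>\<^bsub>V\<^esub>}"
    using assms(2,3,6) p1 one_less_power[of p n] by auto
  note center = center_G[OF ntW]
  obtain v\<^sub>0 where v0: "v\<^sub>0 \<in> carrier V" "v\<^sub>0 \<noteq> \<zero>\<^bsub>V\<^esub>" using ntV by blast
  obtain w\<^sub>0 where w0: "w\<^sub>0 \<in> carrier W" "w\<^sub>0 \<noteq> \<zero>\<^bsub>W\<^esub>" using ntW by blast
  have nonabelian: "group_center G \<noteq> carrier G"
  proof -
    have "(v\<^sub>0, \<zero>\<^bsub>V\<^esub>, \<zero>\<^bsub>W\<^esub>) \<in> carrier G - group_center G"
      using v0 unfolding center carrier_G by simp
    then show ?thesis by blast
  qed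
  have derived: "derived G (carrier G) = group_center G"
    by (rule derived_G[OF ntW nonabelian])
  have "order G = p ^ (n + (n + m))"
    by (simp add: order_def carrier_G card_cartesian_product assms(6,9) power_add)
  then have "finite_p_group p G"
    using p G.group_axioms by (auto simp: finite_p_group_def)
  then have ses: "semi_extraspecial p G"
  proof (rule G.semi_extraspecialI[OF _ commutators_central[OF ntW] _ commutators_surj[OF ntW] nonabelian])
    fix x assume "x \<in> carrier G"
    then show "x [^]\<^bsub>G\<^esub> p \<in> group_center G"
      unfolding center carrier_G by (auto simp: pow_G pV)
  qed
  have exponent: "group_exponent G = p" if "odd p"
    unfolding group_exponent_def
  proof (rule Least_equality)
    have "p dvd p choose 2"
      using p1 that p by (intro dvd_choose_prime) (auto intro: le_neq_implies_less)
    then obtain q where q: "p choose 2 = p * q" by blast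
    have choose: "[(p choose 2)] \<cdot>\<^bsub>W\<^esub> w = \<zero>\<^bsub>W\<^esub>" if "w \<in> carrier W" for w
      using that W.add.nat_pow_pow[of w p q] pW by (simp add: q mult.commute)
    have "x [^]\<^bsub>G\<^esub> p = \<one>\<^bsub>G\<^esub>" if "x \<in> carrier G" for x
      using that unfolding carrier_G by (auto simp: pow_G pV pW choose one_G)
    then show pow: "0 < p \<and> (\<forall>x\<in>carrier G. x [^]\<^bsub>G\<^esub> p = \<one>\<^bsub>G\<^esub>)" using p1 by auto
    fix k :: nat assume k: "0 < k \<and> (\<forall>x\<in>carrier G. x [^]\<^bsub>G\<^esub> k = \<one>\<^bsub>G\<^esub>)"
    let ?x = "(\<zero>\<^bsub>V\<^esub>, \<zero>\<^bsub>V\<^esub>, w\<^sub>0)"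
    have x: "?x \<in> carrier G" "?x \<noteq> \<one>\<^bsub>G\<^esub>" using w0 by (auto simp: carrier_G one_G)
    then have "G.ord ?x dvd p" "G.ord ?x dvd k" "G.ord ?x \<noteq> 1"
      using k pow G.pow_eq_id G.ord_eq_1 by blast+
    then have "p dvd k" using p by (metis prime_nat_iff)
    then show "p \<le> k" using k dvd_imp_le by blast
  qed
  have subA: "subgroup A G"
  proof (rule G.subgroupI)
    show "A \<subseteq> carrier G" by (auto simp: A_def carrier_G)
    show "A \<noteq> {}" using v0 w0 by (auto simp: A_def)
  next
    fix x assume "x \<in> A"
    then show "inv\<^bsub>G\<^esub> x \<in> A" by (auto simp: A_def inv_G)
  next
    fix x y assume "x \<in> A" "y \<in> A"
    then show "x \<otimes>\<^bsub>G\<^esub> y \<in> A" by (auto simp: A_def mult_G)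
  qed
  have subB: "subgroup B G"
  proof (rule G.subgroupI)
    show "B \<subseteq> carrier G" by (auto simp: B_def carrier_G)
    show "B \<noteq> {}" using v0 w0 by (auto simp: B_def)
  next
    fix x assume "x \<in> B"
    then show "inv\<^bsub>G\<^esub> x \<in> B" by (auto simp: B_def inv_G)
  next
    fix x y assume "x \<in> B" "y \<in> B"
    then show "x \<otimes>\<^bsub>G\<^esub> y \<in> B" by (auto simp: B_def mult_G)
  qed
  have commA: "comm_group (G\<lparr>carrier := A\<rparr>)"
    by (rule group.group_comm_groupI[OF G.subgroup_imp_group[OF subA]])
      (auto simp: A_def commute_iff skew_part_def W.minus_eq)
  have cards: "card A = p ^ (n + m)" "card B = p ^ (n + m)"
    by (simp_all add: A_def B_def card_cartesian_product assms(6,9) power_add)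
  have "x \<in> A <#>\<^bsub>G\<^esub> B" if x: "x \<in> carrier G" for x
  proof -
    obtain a b c where x_eq: "x = (a, b, c)" "a \<in> carrier V" "b \<in> carrier V" "c \<in> carrier W"
      using x unfolding carrier_G by blast
    then have "x = (a, \<zero>\<^bsub>V\<^esub>, c \<ominus>\<^bsub>W\<^esub> \<alpha> a b) \<otimes>\<^bsub>G\<^esub> (\<zero>\<^bsub>V\<^esub>, b, \<zero>\<^bsub>W\<^esub>)"
      by (simp add: mult_G W.minus_eq W.a_assoc W.l_neg)
    moreover have "(a, \<zero>\<^bsub>V\<^esub>, c \<ominus>\<^bsub>W\<^esub> \<alpha> a b) \<in> A" "(\<zero>\<^bsub>V\<^esub>, b, \<zero>\<^bsub>W\<^esub>) \<in> B"
      using x_eq by (auto simp: A_def B_def)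
    ultimately show ?thesis unfolding set_mult_def by blast
  qed
  then have prod: "carrier G = A <#>\<^bsub>G\<^esub> B"
    using G.set_mult_closed[OF subgroup.subset[OF subA] subgroup.subset[OF subB]] by blast
  have inter: "A \<inter> B = derived G (carrier G)"
    unfolding derived center A_def B_def by auto
  have commB: "(\<zero>\<^bsub>V\<^esub>, u, c) \<otimes>\<^bsub>G\<^esub> (\<zero>\<^bsub>V\<^esub>, v, d) = (\<zero>\<^bsub>V\<^esub>, v, d) \<otimes>\<^bsub>G\<^esub> (\<zero>\<^bsub>V\<^esub>, u, c) \<longleftrightarrow>
      skew_part W \<beta> u v = \<zero>\<^bsub>W\<^esub>"
    if "u \<in> carrier V" "v \<in> carrier V" "c \<in> carrier W" "d \<in> carrier W" for u v c d
    using that by (simp add: commute_iff W.minus_eq)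
  have skew_sym: "skew_part W \<beta> u v = \<zero>\<^bsub>W\<^esub> \<longleftrightarrow> skew_part W \<beta> v u = \<zero>\<^bsub>W\<^esub>"
    if "u \<in> carrier V" "v \<in> carrier V" for u v
    using that by (auto simp: T.B.skew_eq_zero_iff)
  have centerB: "(\<zero>\<^bsub>V\<^esub>, v, c) \<in> group_center (G\<lparr>carrier := B\<rparr>) \<longleftrightarrow>
      (\<forall>u\<in>carrier V. skew_part W \<beta> u v = \<zero>\<^bsub>W\<^esub>)"
    if "v \<in> carrier V" "c \<in> carrier W" for v c
    using that W.zero_closed skew_sym by (auto simp: group_center_def B_def commB)
  have centralizerB: "B \<subseteq> centralizer G (\<zero>\<^bsub>V\<^esub>, v, c) \<longleftrightarrow>
      (\<forall>u\<in>carrier V. skew_part W \<beta> u v = \<zero>\<^bsub>W\<^esub>)"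
    if "v \<in> carrier V" "c \<in> carrier W" for v c
    using that W.zero_closed by (auto simp: centralizer_def B_def carrier_G commB subset_iff)
  have abelianB: "(\<forall>u\<in>carrier V. \<forall>v\<in>carrier V. skew_part W \<beta> u v = \<zero>\<^bsub>W\<^esub>) \<longleftrightarrow>
      comm_group (G\<lparr>carrier := B\<rparr>)"
  proof
    assume "\<forall>u\<in>carrier V. \<forall>v\<in>carrier V. skew_part W \<beta> u v = \<zero>\<^bsub>W\<^esub>"
    then show "comm_group (G\<lparr>carrier := B\<rparr>)"
      by (intro group.group_comm_groupI[OF G.subgroup_imp_group[OF subB]])
        (auto simp: B_def commB)
  next
    assume "comm_group (G\<lparr>carrier := B\<rparr>)"
    then interpret B: comm_group "G\<lparr>carrier := B\<rparr>" .
    show "\<forall>u\<in>carrier V. \<forall>v\<in>carrier V. skew_part W \<beta> u v = \<zero>\<^bsub>W\<^esub>"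
    proof (intro ballI)
      fix u v assume uv: "u \<in> carrier V" "v \<in> carrier V"
      then have "(\<zero>\<^bsub>V\<^esub>, u, \<zero>\<^bsub>W\<^esub>) \<otimes>\<^bsub>G\<^esub> (\<zero>\<^bsub>V\<^esub>, v, \<zero>\<^bsub>W\<^esub>) = (\<zero>\<^bsub>V\<^esub>, v, \<zero>\<^bsub>W\<^esub>) \<otimes>\<^bsub>G\<^esub> (\<zero>\<^bsub>V\<^esub>, u, \<zero>\<^bsub>W\<^esub>)"
        using B.m_comm[of "(\<zero>\<^bsub>V\<^esub>, u, \<zero>\<^bsub>W\<^esub>)" "(\<zero>\<^bsub>V\<^esub>, v, \<zero>\<^bsub>W\<^esub>)"] by (simp add: B_def)
      then show "skew_part W \<beta> u v = \<zero>\<^bsub>W\<^esub>" using commB uv by simp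
    qed
  qed
  show ?thesis
  proof (intro conjI)
    show "\<forall>v\<in>carrier V - {\<zero>\<^bsub>V\<^esub>}.
           ((\<forall>u\<in>carrier V. skew_part W \<beta> u v = \<zero>\<^bsub>W\<^esub>) \<longleftrightarrow>
            (\<forall>c\<in>carrier W. (\<zero>\<^bsub>V\<^esub>, v, c) \<in> group_center (G\<lparr>carrier := B\<rparr>))) \<and>
           (\<forall>c\<in>carrier W.
              B \<subseteq> centralizer G (\<zero>\<^bsub>V\<^esub>, v, c) \<longleftrightarrow>
              (\<forall>u\<in>carrier V. skew_part W \<beta> u v = \<zero>\<^bsub>W\<^esub>))"
      using centerB centralizerB W.zero_closed by blast
  qed (use ses derived center commutator_G exponent subA subB commA cards prod inter abelianB
        in \<open>blast+\<close>)
qed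

end
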